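(* Let $n$ be a fixed non-negative integer. For each finite word $v\in J^\infty$, the map $\Gamma_v$ defined on $\mathbb{C}\setminus\{0\}$ by $a\mapsto b_{v,a}$, with values in the topological space of rational maps on the Riemann sphere, is continuous.
   Context: Fix a non-negative integer $n$. For $a\in\mathbb{C}\setminus\{0\}$ let $R_a(z)=az^{2^{n+2}}-2az^{2^{n+1}}$. Define operators on functions $f$ (in particular on polynomials in $z$) by $$S_0(f)(z)=f(R_a(z)),\qquad S_1(f)(z)=z^{2^n}f(R_a(z)).$$ Let $J=\{0,1\}$ and $J^\infty=\bigcup_{N=1}^\infty J^N$. For $v=(j_1,\dots,j_N)\in J^\infty$ put $S_v=S_{j_1}\cdots S_{j_N}$ (composition of operators), let $\mathbf{1}$ be the constant function $\mathbf{1}(z)=1$, and let $b_{v,a}(z)=S_v\mathbf{1}(z)$. Each $b_{v,a}$ is a polynomial in $z$, and is regarded as a rational map of the Riemann sphere $\hat{\mathbb{C}}=\mathbb{C}\cup\{\infty\}$ to itself. The space of rational maps carries the topology of uniform convergence on $\hat{\mathbb{C}}$ with respect to the spherical (chordal) metric. *)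

theory Defs
  imports
    "HOL-Analysis.Analysis"
    "HOL-Computational_Algebra.Fundamental_Theorem_Algebra"
begin

section \<open>The Riemann sphere with the chordal metric\<close>

text \<open>The point at infinity is \<^term>\<open>None\<close>.\<close>

type_synonym sphere = "complex option"

fun chordal :: "sphere \<Rightarrow> sphere \<Rightarrow> real" where
  "chordal (Some z) (Some w) = 2 * cmod (z - w) / (sqrt (1 + (cmod z)\<^sup>2) * sqrt (1 + (cmod w)\<^sup>2))"
| "chordal (Some z) None = 2 / sqrt (1 + (cmod z)\<^sup>2)"
| "chordal None (Some w) = 2 / sqrt (1 + (cmod w)\<^sup>2)"
| "chordal None None = 0"

fun stereo :: "sphere \<Rightarrow> complex \<times> real" where
  "stereo (Some z) = (2 * z / of_real (1 + (cmod z)\<^sup>2), ((cmod z)\<^sup>2 - 1) / (1 + (cmod z)\<^sup>2))"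
| "stereo None = (0, 1)"

lemma one_plus_cmod_sq_pos: "1 + (cmod z)\<^sup>2 > 0"
  by (simp add: add_pos_nonneg)

lemma stereo_in_unit_sphere: "norm (stereo x) = 1"
proof (cases x)
  case (Some z)
  define A where "A = 1 + (cmod z)\<^sup>2"
  have A: "A > 0" unfolding A_def by (rule one_plus_cmod_sq_pos)
  have "(cmod (2 * z / of_real A))\<^sup>2 + ((A - 2) / A)\<^sup>2 = 1"
  proof -
    have zA: "(cmod z)\<^sup>2 = A - 1" by (simp add: A_def)
    have "(cmod (2 * z / of_real A))\<^sup>2 = 4 * (A - 1) / A\<^sup>2"
      using A zA by (simp add: norm_divide norm_mult power_divide power_mult_distrib)
    then show ?thesis using A by (simp add: field_simps power2_eq_square)
  qed
  then show ?thesis using Some by (simp add: norm_Pair A_def power_divide)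
qed simp

lemma chordal_commute: "chordal x y = chordal y x"
  by (cases x; cases y) (simp_all add: norm_minus_commute mult.commute)

lemma chordal_nonneg: "chordal x y \<ge> 0"
  by (cases x; cases y) simp_all

lemma chordal_eq_dist_stereo: "chordal x y = dist (stereo x) (stereo y)"
proof -
  have fin_inf: "chordal (Some z) None = dist (stereo (Some z)) (stereo None)" for z
  proof -
    define A where "A = 1 + (cmod z)\<^sup>2"
    have A: "A > 0" unfolding A_def by (rule one_plus_cmod_sq_pos)
    have zA: "(cmod z)\<^sup>2 = A - 1" by (simp add: A_def)
    have "(cmod (2 * z / of_real A))\<^sup>2 = 4 * (A - 1) / A\<^sup>2"
      using A zA by (simp add: norm_divide norm_mult power_divide power_mult_distrib)
    then have "(cmod (2 * z / of_real A))\<^sup>2 + ((A - 2) / A - 1)\<^sup>2 = (2 / sqrt A)\<^sup>2"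
      using A by (simp add: field_simps power2_eq_square)
    then have "sqrt ((cmod (2 * z / of_real A - 0))\<^sup>2 + ((A - 2) / A - 1)\<^sup>2) = 2 / sqrt A"
      using A by simp
    moreover have "(cmod z)\<^sup>2 - 1 = A - 2" by (simp add: A_def)
    ultimately show ?thesis
      by (simp only: chordal.simps stereo.simps dist_Pair_Pair dist_complex_def dist_real_def
          A_def[symmetric] power2_abs)
  qed
  have fin_fin: "chordal (Some z) (Some w) = dist (stereo (Some z)) (stereo (Some w))" for z w
  proof -
    define A where "A = 1 + (cmod z)\<^sup>2"
    define B where "B = 1 + (cmod w)\<^sup>2"
    have A: "A > 0" and B: "B > 0"
      unfolding A_def B_def by (rule one_plus_cmod_sq_pos)+
    define t where "t = Re (z * cnj w)"
    have zw: "(cmod (z - w))\<^sup>2 = (A - 1) + (B - 1) - 2 * t"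
      unfolding A_def B_def t_def cmod_power2 by (simp add: power2_eq_square algebra_simps)
    have "2 * z / of_real A - 2 * w / of_real B
        = 2 * (of_real B * z - of_real A * w) / of_real (A * B)"
      using A B by (simp add: field_simps)
    then have "(cmod (2 * z / of_real A - 2 * w / of_real B))\<^sup>2
        = 4 * (cmod (of_real B * z - of_real A * w))\<^sup>2 / (A * B)\<^sup>2"
      using A B by (simp add: norm_divide norm_mult power_divide power_mult_distrib
          del: right_diff_distrib_numeral)
    moreover have "(cmod (of_real B * z - of_real A * w))\<^sup>2
        = B\<^sup>2 * (A - 1) + A\<^sup>2 * (B - 1) - 2 * A * B * t"
    proof -
      have "(cmod (of_real b * z - of_real a * w))\<^sup>2
          = b\<^sup>2 * (cmod z)\<^sup>2 + a\<^sup>2 * (cmod w)\<^sup>2 - 2 * a * b * t" for a b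
        unfolding t_def cmod_power2 by (simp add: power2_eq_square algebra_simps)
      from this[of B A] show ?thesis by (simp add: A_def B_def)
    qed
    moreover have "4 * (B\<^sup>2 * (A - 1) + A\<^sup>2 * (B - 1) - 2 * A * B * t) / (A * B)\<^sup>2
        + ((A - 2) / A - (B - 2) / B)\<^sup>2 = 4 * ((A - 1) + (B - 1) - 2 * t) / (A * B)"
      using A B by (simp add: divide_simps) (simp add: power2_eq_square algebra_simps)
    ultimately have "(cmod (2 * z / of_real A - 2 * w / of_real B))\<^sup>2
        + ((A - 2) / A - (B - 2) / B)\<^sup>2 = (2 * cmod (z - w) / (sqrt A * sqrt B))\<^sup>2"
      using A B zw by (simp add: power_divide power_mult_distrib)
    then have "sqrt ((cmod (2 * z / of_real A - 2 * w / of_real B))\<^sup>2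
        + ((A - 2) / A - (B - 2) / B)\<^sup>2) = 2 * cmod (z - w) / (sqrt A * sqrt B)"
      using A B by simp
    moreover have "(cmod z)\<^sup>2 - 1 = A - 2" "(cmod w)\<^sup>2 - 1 = B - 2"
      by (simp_all add: A_def B_def)
    ultimately show ?thesis
      by (simp only: chordal.simps stereo.simps dist_Pair_Pair dist_complex_def dist_real_def
          A_def[symmetric] B_def[symmetric] power2_abs)
  qed
  show ?thesis
  proof (cases x)
    case None
    then show ?thesis
    proof (cases y)
      case (Some w)
      then show ?thesis
        using None fin_inf[of w] by (metis chordal_commute dist_commute)
    qed simp
  next
    case (Some z)
    then show ?thesis by (cases y) (simp_all only: fin_inf fin_fin)
  qed
qed

lemma chordal_eq_0_iff: "chordal x y = 0 \<longleftrightarrow> x = y"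
proof -
  have "sqrt (1 + (cmod z)\<^sup>2) \<noteq> 0" for z
    using one_plus_cmod_sq_pos[of z] by simp
  then show ?thesis by (cases x; cases y) (simp_all del: real_sqrt_eq_zero_cancel_iff)
qed

interpretation chordal: Metric_space UNIV chordal
proof
  show "chordal x z \<le> chordal x y + chordal y z" for x y z
    unfolding chordal_eq_dist_stereo by (rule dist_triangle)
qed (simp_all add: chordal_nonneg chordal_commute chordal_eq_0_iff)

definition sphere_metric :: "sphere metric" where
  "sphere_metric = metric (UNIV, chordal)"

lemma mspace_sphere_metric [simp]: "mspace sphere_metric = UNIV"
  and mdist_sphere_metric [simp]: "mdist sphere_metric = chordal"
  by (simp_all add: sphere_metric_def)


section \<open>The space of rational maps\<close>

text \<open>The point of the sphere with homogeneous coordinates \<open>[u : w]\<close>, \<open>(u, w) \<noteq> (0, 0)\<close>.\<close>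

definition sphere_pt :: "complex \<Rightarrow> complex \<Rightarrow> sphere" where
  "sphere_pt u w = (if w = 0 then None else Some (u / w))"

text \<open>
  The self-map \<open>p / q\<close> of the sphere, for coprime \<open>p\<close> and \<open>q\<close>. At infinity, \<open>p\<close> and \<open>q\<close> are
  homogenised in the common degree \<open>d\<close> and evaluated at \<open>[1 : 0]\<close>.
\<close>

definition rat_map :: "complex poly \<Rightarrow> complex poly \<Rightarrow> sphere \<Rightarrow> sphere" where
  "rat_map p q x = (case x of
      Some z \<Rightarrow> sphere_pt (poly p z) (poly q z)
    | None \<Rightarrow> (let d = max (degree p) (degree q) in sphere_pt (coeff p d) (coeff q d)))"

text \<open>All rational maps, of any degree; the constant \<open>\<infinity>\<close> is the case \<open>p = 1\<close>, \<open>q = 0\<close>.\<close>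

definition rational_maps :: "(sphere \<Rightarrow> sphere) set" where
  "rational_maps = {rat_map p q | p q. coprime p q}"

text \<open>
  \<^const>\<open>funspace\<close> carries the metric \<open>sup\<^sub>x chordal (F x) (G x)\<close>, i.e. uniform convergence on the
  whole sphere. It only contains functions with bounded image, which is no restriction here.
\<close>

definition rational_map_metric :: "(sphere \<Rightarrow> sphere) metric" where
  "rational_map_metric = submetric (funspace UNIV sphere_metric) rational_maps"

lemma mspace_rational_map_metric: "mspace rational_map_metric = rational_maps"
proof -
  have "chordal None x \<le> 2" for x
    using dist_triangle_le[of "stereo None" 0 "stereo x" 2]
    by (simp add: chordal_eq_dist_stereo stereo_in_unit_sphere)
  then have "chordal.mbounded A" for A
    unfolding chordal.mbounded_def by (auto simp: chordal.mcball_def)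
  then have "mspace (funspace (UNIV :: sphere set) sphere_metric) = UNIV"
    by (auto simp: chordal.fspace_def)
  then show ?thesis by (simp add: rational_map_metric_def)
qed

lemma mdist_rational_map_metric:
  assumes "F \<in> rational_maps" "G \<in> rational_maps"
  shows "mdist rational_map_metric F G = (SUP x. chordal (F x) (G x))"
proof -
  have "F \<in> chordal.fspace UNIV" "G \<in> chordal.fspace UNIV"
    using assms mspace_rational_map_metric by (auto simp: rational_map_metric_def)
  then show ?thesis by (simp add: rational_map_metric_def chordal.fdist_def)
qed

text \<open>
  A function on the plane regarded as a rational map: the unique rational map whose restriction
  to the plane it is. For polynomials it exists, see \<open>as_rational_map_poly\<close>.
\<close>

definition as_rational_map :: "(complex \<Rightarrow> complex) \<Rightarrow> sphere \<Rightarrow> sphere" where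
  "as_rational_map f = (THE F. F \<in> rational_maps \<and> (\<forall>z. F (Some z) = Some (f z)))"

lemma as_rational_map_poly: "as_rational_map (poly r) = rat_map r 1"
  unfolding as_rational_map_def
proof (rule the_equality)
  show "rat_map r 1 \<in> rational_maps \<and> (\<forall>z. rat_map r 1 (Some z) = Some (poly r z))"
  proof (intro conjI allI)
    show "rat_map r 1 \<in> rational_maps"
      unfolding rational_maps_def using coprime_1_right[of r] by blast
  qed (simp add: rat_map_def sphere_pt_def)
next
  fix F assume F: "F \<in> rational_maps \<and> (\<forall>z. F (Some z) = Some (poly r z))"
  then obtain p q where Fpq: "F = rat_map p q" by (auto simp: rational_maps_def)
  have "poly q z \<noteq> 0 \<and> poly p z = poly r z * poly q z" for z
    using F Fpq by (auto simp: rat_map_def sphere_pt_def field_simps dest!: spec[of _ z]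
        split: if_splits)
  then have nz: "poly q z \<noteq> 0" and "poly p z = poly (r * q) z" for z by simp_all
  then have "poly p = poly (r * q)" by (intro ext)
  then have p: "p = r * q" by (simp only: poly_eq_poly_eq_iff)
  have "constant (poly q)" using fundamental_theorem_of_algebra nz by blast
  then have "degree q = 0" by (simp add: constant_degree)
  then obtain c where q: "q = [:c:]" by (rule degree_eq_zeroE)
  have c: "c \<noteq> 0" using nz[of 0] q by simp
  show "F = rat_map r 1"
  proof
    fix x show "F x = rat_map r 1 x"
      using c by (cases x) (auto simp: Fpq p q rat_map_def sphere_pt_def Let_def coeff_pCons
          mult.commute split: nat.splits)
  qed
qed


section \<open>The operators and the polynomials \<open>b\<close>\<close>

definition R_fun :: "nat \<Rightarrow> complex \<Rightarrow> complex \<Rightarrow> complex" where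
  "R_fun n a z = a * z ^ (2 ^ (n + 2)) - 2 * a * z ^ (2 ^ (n + 1))"

definition S_op :: "nat \<Rightarrow> complex \<Rightarrow> nat \<Rightarrow> (complex \<Rightarrow> complex) \<Rightarrow> complex \<Rightarrow> complex" where
  "S_op n a j f = (\<lambda>z. if j = 0 then f (R_fun n a z) else z ^ (2 ^ n) * f (R_fun n a z))"

definition J :: "nat set" where "J = {0, 1}"

definition J_words :: "nat list set" where
  "J_words = {v. v \<noteq> [] \<and> set v \<subseteq> J}"

text \<open>For \<open>v = [j\<^sub>1, \<dots>, j\<^sub>N]\<close> this is \<open>S\<^bsub>j\<^sub>1\<^esub> \<circ> \<dots> \<circ> S\<^bsub>j\<^sub>N\<^esub>\<close>; the innermost operator is that of the last letter.\<close>

definition S_word :: "nat \<Rightarrow> complex \<Rightarrow> nat list \<Rightarrow> (complex \<Rightarrow> complex) \<Rightarrow> complex \<Rightarrow> complex" where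
  "S_word n a v = foldr (\<lambda>j T. S_op n a j \<circ> T) v id"

definition b :: "nat \<Rightarrow> nat list \<Rightarrow> complex \<Rightarrow> complex \<Rightarrow> complex" where
  "b n v a = S_word n a v (\<lambda>z. 1)"

definition Gamma_map :: "nat \<Rightarrow> nat list \<Rightarrow> complex \<Rightarrow> sphere \<Rightarrow> sphere" where
  "Gamma_map n v a = as_rational_map (b n v a)"

lemma b_is_poly: "\<exists>p. b n v a = poly p"
proof (induction v)
  case Nil
  have "b n [] a = poly 1" by (auto simp: b_def S_word_def)
  then show ?case by blast
next
  case (Cons j v)
  then obtain p where p: "b n v a = poly p" by blast
  define R where "R = monom a (2 ^ (n + 2)) - monom (2 * a) (2 ^ (n + 1))"
  have "R_fun n a z = poly R z" for z by (simp add: R_fun_def R_def poly_monom)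
  moreover have "b n (j # v) a = S_op n a j (b n v a)" by (simp add: b_def S_word_def)
  ultimately have "b n (j # v) a
      = poly (if j = 0 then pcompose p R else monom 1 (2 ^ n) * pcompose p R)"
    by (auto simp: S_op_def p poly_pcompose poly_monom)
  then show ?case by blast
qed

end

theory Submission
  imports Defs
begin

text \<open>
  Either \<open>b\<^bsub>v,a\<^esub> = 1\<close> for all \<open>a\<close> (when \<open>v\<close> contains no \<open>1\<close>), or \<open>b\<^bsub>v,a\<^esub>(z) \<rightarrow> \<infinity>\<close> as \<open>z \<rightarrow> \<infinity>\<close>, locally
  uniformly in \<open>a \<noteq> 0\<close>; this passes through \<open>S\<^sub>0\<close> and \<open>S\<^sub>1\<close> because \<open>R\<^sub>a(z) \<rightarrow> \<infinity>\<close> in the same sense.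
  In the second case all \<open>b\<^bsub>v,a\<^esub>\<close> with \<open>a\<close> near \<open>a\<^sub>0\<close> are chordally close to \<open>\<infinity>\<close> outside one
  large disc, while on that disc uniform closeness follows from joint continuity in \<open>(a, z)\<close>.
\<close>

lemma b_Nil: "b n [] a z = 1"
  by (simp add: b_def S_word_def)

lemma b_Cons:
  "b n (j # v) a z = (if j = 0 then 1 else z ^ (2 ^ n)) * b n v a (R_fun n a z)"
  by (simp add: b_def S_word_def S_op_def)

lemma continuous_on_R_fun [continuous_intros]:
  assumes "continuous_on A f" "continuous_on A g"
  shows "continuous_on A (\<lambda>x. R_fun n (f x) (g x))"
  unfolding R_fun_def by (intro continuous_intros assms)

text \<open>Joint continuity in the parameter and the point. The induction must leave
  \<open>g\<close> arbitrary, since each letter replaces \<open>g\<close> by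
  \<open>R_fun n (f x) (g x)\<close>.\<close>

lemma continuous_on_b:
  assumes "continuous_on A f" "continuous_on A g"
  shows "continuous_on A (\<lambda>x. b n v (f x) (g x))"
  using assms
proof (induction v arbitrary: g)
  case (Cons j v)
  have "continuous_on A (\<lambda>x. b n v (f x) (R_fun n (f x) (g x)))"
    by (intro Cons.IH continuous_intros Cons.prems)
  then show ?case
    unfolding b_Cons using Cons.prems by (cases "j = 0") (auto intro!: continuous_intros)
qed (simp add: b_Nil)

text \<open>With m = 2^(n+1), R_c(w) = c w^m (w^m - 2). The product form avoids a difference of two
  infinite limits: c tends to a nonzero limit and both other factors blow up.\<close>

lemma filterlim_R_fun_at_infinity:
  assumes "(f \<longlongrightarrow> a) F" "a \<noteq> 0" "filterlim g at_infinity F"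
  shows "filterlim (\<lambda>x. R_fun n (f x) (g x)) at_infinity F"
proof -
  have pow: "filterlim (\<lambda>x. g x ^ (2 ^ (n + 1))) at_infinity F"
    by (intro Limits.filterlim_power_at_infinity assms) simp
  have shift: "filterlim (\<lambda>x. - 2 + g x ^ (2 ^ (n + 1))) at_infinity F"
    by (intro tendsto_add_filterlim_at_infinity[OF tendsto_const] pow)
  have "filterlim (\<lambda>x. f x * (g x ^ (2 ^ (n + 1)) * (- 2 + g x ^ (2 ^ (n + 1))))) at_infinity F"
    using assms(1,2)
    by (intro tendsto_mult_filterlim_at_infinity[of f a] filterlim_at_infinity_times pow shift)
  moreover have "R_fun n c w = c * (w ^ (2 ^ (n + 1)) * (- 2 + w ^ (2 ^ (n + 1))))" for c w
  proof -
    have "(2::nat) ^ (n + 2) = 2 ^ (n + 1) + 2 ^ (n + 1)" by simp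
    then have "w ^ (2 ^ (n + 2)) = w ^ (2 ^ (n + 1)) * w ^ (2 ^ (n + 1))"
      by (simp only: power_add)
    then show ?thesis
      unfolding R_fun_def by (simp only: ring_distribs) simp
  qed
  ultimately show ?thesis by (simp only:)
qed

lemma b_trivial_or_filterlim_at_infinity:
  "(\<forall>a z. b n v a z = 1) \<or>
   (\<forall>a. a \<noteq> 0 \<longrightarrow> filterlim (\<lambda>(c, z). b n v c z) at_infinity (nhds a \<times>\<^sub>F at_infinity))"
proof (induction v)
  case (Cons j v)
  have z: "filterlim (snd :: _ \<Rightarrow> complex) at_infinity (nhds a \<times>\<^sub>F at_infinity)"
    and c: "((fst :: _ \<times> complex \<Rightarrow> _) \<longlongrightarrow> a) (nhds a \<times>\<^sub>F at_infinity)" for a :: complex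
    by (rule filterlim_snd filterlim_fst)+
  have zn: "filterlim (\<lambda>x. (snd x :: complex) ^ (2 ^ n)) at_infinity (nhds a \<times>\<^sub>F at_infinity)"
    for a :: complex
    by (intro Limits.filterlim_power_at_infinity z) simp
  from Cons.IH show ?case
  proof
    \<comment> \<open>A letter 0 preserves the constant 1; the first nonzero letter, read from the
      right, gives z^(2^n), which starts the second alternative.\<close>
    assume "\<forall>a z. b n v a z = 1"
    then show ?thesis
      using zn by (cases "j = 0") (simp_all add: b_Cons case_prod_unfold)
  next
    assume IH: "\<forall>a. a \<noteq> 0 \<longrightarrow>
      filterlim (\<lambda>(c, z). b n v c z) at_infinity (nhds a \<times>\<^sub>F at_infinity)"
    have "filterlim (\<lambda>x. b n v (fst x) (R_fun n (fst x) (snd x))) at_infinity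
        (nhds a \<times>\<^sub>F at_infinity)" if a: "a \<noteq> 0" for a
    proof -
      \<comment> \<open>The substitution (c, z) -> (c, R_c(z)) respects the product filter, so the
        induction hypothesis can be composed with it.\<close>
      have "filterlim (\<lambda>x. (fst x, R_fun n (fst x) (snd x))) (nhds a \<times>\<^sub>F at_infinity)
          (nhds a \<times>\<^sub>F at_infinity)"
        by (intro filterlim_Pair c filterlim_R_fun_at_infinity[OF c a z])
      from filterlim_compose[OF IH[rule_format, OF a] this] show ?thesis by simp
    qed
    then show ?thesis
      by (cases "j = 0")
        (auto simp: b_Cons case_prod_unfold intro!: filterlim_at_infinity_times zn)
  qed
qed (simp add: b_Nil)

lemma Gamma_map_Some: "Gamma_map n v a (Some z) = Some (b n v a z)"
proof -
  obtain p where p: "b n v a = poly p" using b_is_poly by blast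
  then show ?thesis
    by (simp add: Gamma_map_def as_rational_map_poly rat_map_def sphere_pt_def)
qed

lemma Gamma_map_in_rational_maps: "Gamma_map n v a \<in> rational_maps"
proof -
  obtain p where p: "b n v a = poly p" using b_is_poly by blast
  show ?thesis
    unfolding Gamma_map_def p as_rational_map_poly rational_maps_def
    using coprime_1_right[of p] by blast
qed

text \<open>A nonconstant p over the denominator 1 has the value infinity there, because 1 has zero
  coefficient at \<open>degree p\<close>; a constant p is excluded by its finite limit.\<close>

lemma Gamma_map_None:
  assumes "filterlim (b n v a) at_infinity at_infinity"
  shows "Gamma_map n v a None = None"
proof -
  obtain p where p: "b n v a = poly p" using b_is_poly by blast
  have "degree p \<noteq> 0"
  proof
    assume "degree p = 0"
    then obtain c where "p = [:c:]" by (rule degree_eq_zeroE)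
    then have "b n v a = (\<lambda>_. c)" using p by (simp add: fun_eq_iff)
    then have "filterlim (\<lambda>_::complex. c) at_infinity at_infinity" using assms by simp
    then show False
      using not_tendsto_and_filterlim_at_infinity[OF _ tendsto_const] trivial_limit_at_infinity
      by blast
  qed
  then show ?thesis
    by (simp add: Gamma_map_def p as_rational_map_poly rat_map_def sphere_pt_def Let_def)
qed

lemma chordal_Some_le: "chordal (Some z) (Some w) \<le> 2 * dist z w"
proof -
  define s where "s = sqrt (1 + (cmod z)\<^sup>2) * sqrt (1 + (cmod w)\<^sup>2)"
  have "1 \<le> s"
    unfolding s_def
    using mult_mono[of 1 "sqrt (1 + (cmod z)\<^sup>2)" 1 "sqrt (1 + (cmod w)\<^sup>2)"] by simp
  then have "2 * cmod (z - w) / s \<le> 2 * cmod (z - w) / 1"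
    by (intro divide_left_mono) auto
  then show ?thesis by (simp add: s_def dist_norm)
qed

lemma chordal_Some_None_le:
  assumes "0 < r" "r \<le> cmod z"
  shows "chordal (Some z) None \<le> 2 / r"
proof -
  have "r \<le> sqrt (1 + (cmod z)\<^sup>2)"
    using assms by (intro real_le_rsqrt) (smt (verit) power_mono)
  then show ?thesis using assms by (simp add: frac_le)
qed

text \<open>Triangle inequality through the point at infinity.\<close>

lemma chordal_large_le:
  assumes "0 < r" "r \<le> cmod z" "r \<le> cmod w"
  shows "chordal (Some z) (Some w) \<le> 4 / r"
proof -
  have "chordal (Some z) (Some w) \<le> chordal (Some z) None + chordal None (Some w)"
    by (rule chordal.triangle) auto
  also have "\<dots> \<le> 2 / r + 2 / r"
    using chordal_Some_None_le[OF assms(1,2)] chordal_Some_None_le[OF assms(1,3)]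
    by (simp only: chordal_commute[of None])
  finally show ?thesis by simp
qed

lemma eventually_chordal_Gamma_map_le:
  assumes a: "a \<noteq> 0" and e: "e > 0"
  shows "\<forall>\<^sub>F c in nhds a. \<forall>x. chordal (Gamma_map n v a x) (Gamma_map n v c x) \<le> e"
  using b_trivial_or_filterlim_at_infinity[of n v]
proof
  assume "\<forall>a z. b n v a z = 1"
  then have "b n v = (\<lambda>_ _. 1)" by (simp add: fun_eq_iff)
  then show ?thesis using e by (simp add: Gamma_map_def)
next
  assume "\<forall>a. a \<noteq> 0 \<longrightarrow>
    filterlim (\<lambda>(c, z). b n v c z) at_infinity (nhds a \<times>\<^sub>F at_infinity)"
  then have lim: "filterlim (\<lambda>(c, z). b n v c z) at_infinity (nhds c \<times>\<^sub>F at_infinity)"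
    if "c \<noteq> 0" for c
    using that by blast
  have inf: "Gamma_map n v c None = None" if c: "c \<noteq> 0" for c
  proof (rule Gamma_map_None)
    \<comment> \<open>Restrict the joint limit to the slice with fixed parameter c.\<close>
    have "filterlim (\<lambda>z::complex. (c, z)) (nhds c \<times>\<^sub>F at_infinity) at_infinity"
      by (intro filterlim_Pair tendsto_const filterlim_ident)
    from filterlim_compose[OF lim[OF c] this]
    show "filterlim (b n v c) at_infinity at_infinity" by simp
  qed
  \<comment> \<open>The threshold 4 / e turns the bound of \<open>chordal_large_le\<close> into
    exactly e.\<close>
  have "\<forall>\<^sub>F x in nhds a \<times>\<^sub>F at_infinity. 4 / e \<le> cmod (case x of (c, z) \<Rightarrow> b n v c z)"
    using lim[OF a] e unfolding filterlim_at_infinity[OF order_refl] by simp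
  then obtain P Q where P: "eventually P (nhds a)" and Q: "eventually Q at_infinity"
    and PQ: "\<And>c z. P c \<Longrightarrow> Q z \<Longrightarrow> 4 / e \<le> cmod (b n v c z)"
    unfolding eventually_prod_filter by auto
  from Q obtain r where r: "\<And>z. r \<le> cmod z \<Longrightarrow> Q z"
    unfolding eventually_at_infinity by blast
  have "uniformly_continuous_on (cball a 1 \<times> cball 0 r) (\<lambda>x. b n v (fst x) (snd x))"
    by (intro compact_uniformly_continuous continuous_on_b compact_Times continuous_intros) auto
  \<comment> \<open>The tolerance e / 2 absorbs the factor 2 of
    \<open>chordal_Some_le\<close>.\<close>
  then obtain d where d: "d > 0" and close: "\<And>x y. x \<in> cball a 1 \<times> cball 0 r \<Longrightarrow>
      y \<in> cball a 1 \<times> cball 0 r \<Longrightarrow> dist y x < d \<Longrightarrow>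
      dist (b n v (fst y) (snd y)) (b n v (fst x) (snd x)) < e / 2"
    using e unfolding uniformly_continuous_on_def by (meson half_gt_zero)
  \<comment> \<open>The bound 1 keeps c in the compact parameter ball, d serves uniform continuity,
    and c \<noteq> 0 makes infinity a fixed point.\<close>
  have "\<forall>\<^sub>F c in nhds a. P c \<and> c \<noteq> 0 \<and> dist a c < min 1 d"
  proof (intro eventually_conj P)
    show "\<forall>\<^sub>F c in nhds a. c \<noteq> 0"
      using a by (rule t1_space_nhds)
    show "\<forall>\<^sub>F c in nhds a. dist a c < min 1 d"
      using d unfolding eventually_nhds_metric by (metis dist_commute min_less_iff_conj zero_less_one)
  qed
  then show ?thesis
  proof eventually_elim
    case (elim c)
    show ?case
    proof
      fix x
      show "chordal (Gamma_map n v a x) (Gamma_map n v c x) \<le> e"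
      proof (cases x)
        case None
        then show ?thesis using inf a elim e by simp
      next
        case (Some z)
        have "chordal (Some (b n v a z)) (Some (b n v c z)) \<le> e"
        proof (cases "r \<le> cmod z")
          case True
          \<comment> \<open>Both values must be large, so P is also needed at the centre a
            itself.\<close>
          then show ?thesis
            using chordal_large_le[of "4 / e" "b n v a z" "b n v c z"] e PQ r elim
              eventually_nhds_x_imp_x[OF P] by simp
        next
          case False
          then have "dist (b n v a z) (b n v c z) < e / 2"
            using close[of "(c, z)" "(a, z)"] elim by (simp add: dist_Pair_Pair)
          then show ?thesis
            using chordal_Some_le[of "b n v a z" "b n v c z"] by linarith
        qed
        then show ?thesis by (simp only: Some Gamma_map_Some)
      qed
    qed
  qed
qed

theorem theorem5p4:
  fixes n :: nat and v :: "nat list"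
  assumes "v \<in> J_words"
  shows "continuous_map (top_of_set (UNIV - {0})) (mtopology_of rational_map_metric) (Gamma_map n v)"
proof -
  interpret M: Metric_space "mspace rational_map_metric" "mdist rational_map_metric"
    by (rule Metric_space_mspace_mdist)
  have "\<exists>U. openin (top_of_set (UNIV - {0})) U \<and> a \<in> U \<and>
      (\<forall>c\<in>U. Gamma_map n v c \<in> M.mball (Gamma_map n v a) e)"
    if a: "a \<in> UNIV - {0}" and e: "e > 0" for a e
  proof -
    \<comment> \<open>Pointwise bounds by e / 2 keep the supremum strictly below e, as the open ball
      demands.\<close>
    obtain S where S: "open S" "a \<in> S"
      and *: "\<And>c x. c \<in> S \<Longrightarrow> chordal (Gamma_map n v a x) (Gamma_map n v c x) \<le> e / 2"
      using eventually_chordal_Gamma_map_le[of a "e / 2" n v] a e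
      unfolding eventually_nhds by auto
    have "mdist rational_map_metric (Gamma_map n v a) (Gamma_map n v c) < e" if "c \<in> S" for c
    proof -
      have "(SUP x. chordal (Gamma_map n v a x) (Gamma_map n v c x)) \<le> e / 2"
        using * that by (intro cSUP_least) auto
      then show ?thesis
        using e by (simp add: mdist_rational_map_metric Gamma_map_in_rational_maps)
    qed
    then show ?thesis
      using S a Gamma_map_in_rational_maps[of n v, folded mspace_rational_map_metric]
      by (intro exI[of _ "(UNIV - {0}) \<inter> S"]) (simp add: openin_open_Int)
  qed
  then show ?thesis
    unfolding mtopology_of_def M.continuous_map_to_metric by simp
qed

end
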